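(* Let $\mathbf{k}$ be a unitary commutative ring, $\lambda\in\mathbf{k}$, $R$ a unitary associative $\mathbf{k}$-algebra, $\Omega$ a nonempty set, and let $\{r_\omega=\sum_i u_{\omega,i}\otimes v_{\omega,i}\in R\otimes R\mid\omega\in\Omega\}$ be a solution of the polarized associative Yang-Baxter equation of weight $\lambda$. Suppose that $r_{12}s_{23}=s_{12}r_{23}$ for all pairs $(r,s)=(r_\alpha,r_\beta)$, $\alpha,\beta\in\Omega$. Then the linear operators $$P_\omega:R\to R,\qquad P_\omega(x):=\sum_i u_{\omega,i}\,x\,v_{\omega,i},\qquad\omega\in\Omega,$$ make $(R,\{P_\omega\mid\omega\in\Omega\})$ a matching Rota-Baxter algebra of weight $\lambda$.
   Context: For $r=\sum_i u_i\otimes v_i\in R\otimes R$ write, in the algebra $R\otimes R\otimes R$, $r_{12}=\sum_i u_i\otimes v_i\otimes 1$, $r_{13}=\sum_i u_i\otimes 1\otimes v_i$, $r_{23}=\sum_i 1\otimes u_i\otimes v_i$. A family $\{r_\omega\mid\omega\in\Omega\}$ of elements of $R\otimes R$ is a solution of the polarized associative Yang-Baxter equation of weight $\lambda$ if for every pair $(r,s)=(r_\alpha,r_\beta)$ with $\alpha,\beta\in\Omega$, $$r_{13}s_{12}-r_{12}s_{23}+r_{23}s_{13}=-\lambda s_{13}.$$ A matching Rota-Baxter algebra of weight $\lambda$ is a pair $(R,\{P_\omega\mid\omega\in\Omega\})$ where $R$ is an associative $\mathbf{k}$-algebra and $P_\omega:R\to R$ are $\mathbf{k}$-linear operators such that $$P_\alpha(x)P_\beta(y)=P_\alpha(xP_\beta(y))+P_\beta(P_\alpha(x)y)+\lambda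 P_\alpha(xy)\quad\text{for all }x,y\in R,\ \alpha,\beta\in\Omega .$$ *)

theory Defs
  imports "HOL-Algebra.Algebra"
begin

text \<open>
  The locale \<^locale>\<open>algebra\<close> of HOL-Algebra is restricted to commutative algebras.  The following
  locale describes a unital associative, not necessarily commutative, algebra over a commutative
  ring; as usual in HOL-Algebra, the zero ring is allowed both for \<open>K\<close> and for \<open>R\<close>.
\<close>

locale assoc_algebra = module K R + ring R for K (structure) and R (structure) +
  assumes smult_mult_left:
      "\<lbrakk>k \<in> carrier K; x \<in> carrier R; y \<in> carrier R\<rbrakk> \<Longrightarrow>
        (k \<odot>\<^bsub>R\<^esub> x) \<otimes>\<^bsub>R\<^esub> y = k \<odot>\<^bsub>R\<^esub> (x \<otimes>\<^bsub>R\<^esub> y)"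
    and smult_mult_right:
      "\<lbrakk>k \<in> carrier K; x \<in> carrier R; y \<in> carrier R\<rbrakk> \<Longrightarrow>
        x \<otimes>\<^bsub>R\<^esub> (k \<odot>\<^bsub>R\<^esub> y) = k \<odot>\<^bsub>R\<^esub> (x \<otimes>\<^bsub>R\<^esub> y)"

definition linear_operator ::
  "('k, 'm) ring_scheme \<Rightarrow> ('k, 'r, 'n) module_scheme \<Rightarrow> ('r \<Rightarrow> 'r) \<Rightarrow> bool" where
  "linear_operator K R f \<longleftrightarrow>
     f \<in> carrier R \<rightarrow> carrier R \<and>
     (\<forall>x\<in>carrier R. \<forall>y\<in>carrier R. f (x \<oplus>\<^bsub>R\<^esub> y) = f x \<oplus>\<^bsub>R\<^esub> f y) \<and>
     (\<forall>k\<in>carrier K. \<forall>x\<in>carrier R. f (k \<odot>\<^bsub>R\<^esub> x) = k \<odot>\<^bsub>R\<^esub> f x)"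

definition matching_rota_baxter_algebra ::
  "('k, 'm) ring_scheme \<Rightarrow> 'k \<Rightarrow> ('k, 'r, 'n) module_scheme \<Rightarrow> 'i set \<Rightarrow> ('i \<Rightarrow> 'r \<Rightarrow> 'r) \<Rightarrow> bool"
  where
  "matching_rota_baxter_algebra K l R \<Omega> P \<longleftrightarrow>
     assoc_algebra K R \<and>
     (\<forall>\<omega>\<in>\<Omega>. linear_operator K R (P \<omega>)) \<and>
     (\<forall>\<alpha>\<in>\<Omega>. \<forall>\<beta>\<in>\<Omega>. \<forall>x\<in>carrier R. \<forall>y\<in>carrier R.
        P \<alpha> x \<otimes>\<^bsub>R\<^esub> P \<beta> y =
          P \<alpha> (x \<otimes>\<^bsub>R\<^esub> P \<beta> y) \<oplus>\<^bsub>R\<^esub> P \<beta> (P \<alpha> x \<otimes>\<^bsub>R\<^esub> y) \<oplus>\<^bsub>R\<^esub> l \<odot>\<^bsub>R\<^esub> P \<alpha> (x \<otimes>\<^bsub>R\<^esub> y))"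


section \<open>Tensor powers of an algebra\<close>

text \<open>
  For \<open>n \<ge> 1\<close>, the tensor power \<open>R \<otimes> \<dots> \<otimes> R\<close> (\<open>n\<close> factors, over \<open>K\<close>) is the free abelian group on
  \<open>R\<^sup>n\<close> modulo the subgroup generated by the relations of additivity in each slot and of
  \<open>K\<close>-balancedness between any two slots; this is Bourbaki's construction (only \<open>n = 2\<close> and
  \<open>n = 3\<close> are used below).  An \<open>n\<close>-tuple is a list of length \<open>n\<close>, an element of the free abelian
  group is a finitely supported integer-valued function, and an element of the tensor power is a
  coset.
\<close>

definition tuples :: "('k, 'r, 'n) module_scheme \<Rightarrow> nat \<Rightarrow> 'r list set" where
  "tuples R n = {xs. length xs = n \<and> set xs \<subseteq> carrier R}"

definition formal_tensors :: "('k, 'r, 'n) module_scheme \<Rightarrow> nat \<Rightarrow> ('r list \<Rightarrow>\<^sub>0 int) monoid" where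
  "formal_tensors R n = free_Abelian_group (tuples R n)"

definition tensor_relators ::
  "('k, 'm) ring_scheme \<Rightarrow> ('k, 'r, 'n) module_scheme \<Rightarrow> nat \<Rightarrow> ('r list \<Rightarrow>\<^sub>0 int) set" where
  "tensor_relators K R n =
     {frag_of (xs[i := a \<oplus>\<^bsub>R\<^esub> b]) - frag_of (xs[i := a]) - frag_of (xs[i := b]) | xs i a b.
        xs \<in> tuples R n \<and> i < n \<and> a \<in> carrier R \<and> b \<in> carrier R} \<union>
     {frag_of (xs[i := k \<odot>\<^bsub>R\<^esub> xs ! i]) - frag_of (xs[j := k \<odot>\<^bsub>R\<^esub> xs ! j]) | xs i j k.
        xs \<in> tuples R n \<and> i < n \<and> j < n \<and> k \<in> carrier K}"

definition null_tensors ::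
  "('k, 'm) ring_scheme \<Rightarrow> ('k, 'r, 'n) module_scheme \<Rightarrow> nat \<Rightarrow> ('r list \<Rightarrow>\<^sub>0 int) set" where
  "null_tensors K R n = generate (formal_tensors R n) (tensor_relators K R n)"

definition tensor_class ::
  "('k, 'm) ring_scheme \<Rightarrow> ('k, 'r, 'n) module_scheme \<Rightarrow> nat \<Rightarrow> ('r list \<Rightarrow>\<^sub>0 int) \<Rightarrow>
     ('r list \<Rightarrow>\<^sub>0 int) set" where
  "tensor_class K R n c = null_tensors K R n #>\<^bsub>formal_tensors R n\<^esub> c"

definition pure_tensor ::
  "('k, 'm) ring_scheme \<Rightarrow> ('k, 'r, 'n) module_scheme \<Rightarrow> 'r list \<Rightarrow> ('r list \<Rightarrow>\<^sub>0 int) set" where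
  "pure_tensor K R xs = tensor_class K R (length xs) (frag_of xs)"

text \<open>
  The product and the scalar multiplication are those determined by
  \<open>(x\<^sub>1 \<otimes> \<dots> \<otimes> x\<^sub>n) (y\<^sub>1 \<otimes> \<dots> \<otimes> y\<^sub>n) = x\<^sub>1 y\<^sub>1 \<otimes> \<dots> \<otimes> x\<^sub>n y\<^sub>n\<close> and
  \<open>k (x\<^sub>1 \<otimes> \<dots> \<otimes> x\<^sub>n) = k x\<^sub>1 \<otimes> x\<^sub>2 \<otimes> \<dots> \<otimes> x\<^sub>n\<close>.  As for \<^const>\<open>rcoset_mult\<close> in the library, an
  operation on cosets is the union of the cosets obtained from all representatives, which is a
  single coset because the choice of representatives does not matter.
\<close>

definition formal_mult ::
  "('k, 'r, 'n) module_scheme \<Rightarrow> ('r list \<Rightarrow>\<^sub>0 int) \<Rightarrow> ('r list \<Rightarrow>\<^sub>0 int) \<Rightarrow> ('r list \<Rightarrow>\<^sub>0 int)" where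
  "formal_mult R c d =
     frag_extend (\<lambda>xs. frag_extend (\<lambda>ys. frag_of (map2 (\<otimes>\<^bsub>R\<^esub>) xs ys)) d) c"

definition formal_smult ::
  "('k, 'r, 'n) module_scheme \<Rightarrow> 'k \<Rightarrow> ('r list \<Rightarrow>\<^sub>0 int) \<Rightarrow> ('r list \<Rightarrow>\<^sub>0 int)" where
  "formal_smult R k c = frag_extend (\<lambda>xs. frag_of (xs[0 := k \<odot>\<^bsub>R\<^esub> xs ! 0])) c"

definition tensor_power ::
  "('k, 'm) ring_scheme \<Rightarrow> ('k, 'r, 'n) module_scheme \<Rightarrow> nat \<Rightarrow>
     ('k, ('r list \<Rightarrow>\<^sub>0 int) set) module" where
  "tensor_power K R n =
     \<lparr>carrier = carrier (formal_tensors R n Mod null_tensors K R n),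
      monoid.mult = (\<lambda>s t. \<Union>c\<in>s. \<Union>d\<in>t. tensor_class K R n (formal_mult R c d)),
      one = pure_tensor K R (replicate n \<one>\<^bsub>R\<^esub>),
      ring.zero = \<one>\<^bsub>formal_tensors R n Mod null_tensors K R n\<^esub>,
      add = (\<otimes>\<^bsub>formal_tensors R n Mod null_tensors K R n\<^esub>),
      smult = (\<lambda>k t. \<Union>c\<in>t. tensor_class K R n (formal_smult R k c))\<rparr>"


section \<open>The polarized associative Yang-Baxter equation\<close>

text \<open>
  The additive maps from \<open>R \<otimes> R\<close> to \<open>R \<otimes> R \<otimes> R\<close> sending \<open>u \<otimes> v\<close> to
  \<open>u \<otimes> v \<otimes> 1\<close>, \<open>u \<otimes> 1 \<otimes> v\<close> and \<open>1 \<otimes> u \<otimes> v\<close>.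
\<close>

definition place12 ::
  "('k, 'm) ring_scheme \<Rightarrow> ('k, 'r, 'n) module_scheme \<Rightarrow>
     ('r list \<Rightarrow>\<^sub>0 int) set \<Rightarrow> ('r list \<Rightarrow>\<^sub>0 int) set" where
  "place12 K R t =
     (\<Union>c\<in>t. tensor_class K R 3 (frag_extend (\<lambda>xs. frag_of [xs ! 0, xs ! 1, \<one>\<^bsub>R\<^esub>]) c))"

definition place13 ::
  "('k, 'm) ring_scheme \<Rightarrow> ('k, 'r, 'n) module_scheme \<Rightarrow>
     ('r list \<Rightarrow>\<^sub>0 int) set \<Rightarrow> ('r list \<Rightarrow>\<^sub>0 int) set" where
  "place13 K R t =
     (\<Union>c\<in>t. tensor_class K R 3 (frag_extend (\<lambda>xs. frag_of [xs ! 0, \<one>\<^bsub>R\<^esub>, xs ! 1]) c))"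

definition place23 ::
  "('k, 'm) ring_scheme \<Rightarrow> ('k, 'r, 'n) module_scheme \<Rightarrow>
     ('r list \<Rightarrow>\<^sub>0 int) set \<Rightarrow> ('r list \<Rightarrow>\<^sub>0 int) set" where
  "place23 K R t =
     (\<Union>c\<in>t. tensor_class K R 3 (frag_extend (\<lambda>xs. frag_of [\<one>\<^bsub>R\<^esub>, xs ! 0, xs ! 1]) c))"

definition polarized_AYBE_solution ::
  "('k, 'm) ring_scheme \<Rightarrow> 'k \<Rightarrow> ('k, 'r, 'n) module_scheme \<Rightarrow> 'i set \<Rightarrow>
     ('i \<Rightarrow> ('r list \<Rightarrow>\<^sub>0 int) set) \<Rightarrow> bool" where
  "polarized_AYBE_solution K l R \<Omega> r \<longleftrightarrow>
     (\<forall>\<omega>\<in>\<Omega>. r \<omega> \<in> carrier (tensor_power K R 2)) \<and>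
     (let T = tensor_power K R 3 in
      \<forall>\<alpha>\<in>\<Omega>. \<forall>\<beta>\<in>\<Omega>.
        ((place13 K R (r \<alpha>) \<otimes>\<^bsub>T\<^esub> place12 K R (r \<beta>))
          \<ominus>\<^bsub>T\<^esub> (place12 K R (r \<alpha>) \<otimes>\<^bsub>T\<^esub> place23 K R (r \<beta>)))
          \<oplus>\<^bsub>T\<^esub> (place23 K R (r \<alpha>) \<otimes>\<^bsub>T\<^esub> place13 K R (r \<beta>))
        = (\<ominus>\<^bsub>K\<^esub> l) \<odot>\<^bsub>T\<^esub> place13 K R (r \<beta>))"

end

theory Submission
  imports Defs
begin

text \<open>
  For fixed \<open>x\<close> and \<open>y\<close> the additive map \<open>a \<otimes> b \<otimes> c \<mapsto> a x b y c\<close> on \<open>R \<otimes> R \<otimes> R\<close> sends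
  \<open>r\<^sub>1\<^sub>3 s\<^sub>1\<^sub>2\<close>, \<open>r\<^sub>1\<^sub>2 s\<^sub>2\<^sub>3\<close>, \<open>r\<^sub>2\<^sub>3 s\<^sub>1\<^sub>3\<close> and \<open>s\<^sub>1\<^sub>3\<close> to \<open>P (Q x y)\<close>, \<open>P x Q y\<close>, \<open>Q (x P y)\<close> and
  \<open>Q (x y)\<close>, where \<open>P\<close> and \<open>Q\<close> are the operators of \<open>r\<close> and \<open>s\<close>.  Applied to the Yang-Baxter equation
  of the pair \<open>(r\<^sub>\<beta>, r\<^sub>\<alpha>)\<close> it expresses \<open>P\<^sub>\<beta> x P\<^sub>\<alpha> y\<close> by the right-hand side of the matching
  Rota-Baxter equation of \<open>(\<alpha>, \<beta>)\<close>, and applied to the exchange hypothesis it gives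
  \<open>P\<^sub>\<alpha> x P\<^sub>\<beta> y = P\<^sub>\<beta> x P\<^sub>\<alpha> y\<close>.
\<close>

section \<open>Products of formal tensors and updates of tuples\<close>

lemma formal_mult_add_left: "formal_mult R (a + b) d = formal_mult R a d + formal_mult R b d"
  by (simp add: formal_mult_def frag_extend_add)

text \<open>Additivity in the left factor is that of the outer \<open>frag_extend\<close>. The right
  factor sits inside the function being extended, so here \<open>c\<close> is first reduced to
  single tuples by induction.\<close>

lemma formal_mult_add_right: "formal_mult R c (a + b) = formal_mult R c a + formal_mult R c b"
proof -
  have "Poly_Mapping.keys c \<subseteq> UNIV" by simp
  then show ?thesis
    by (induction c rule: frag_induction) (auto simp: formal_mult_def frag_extend_add frag_extend_diff)
qed

lemma formal_mult_diff_left: "formal_mult R (a - b) d = formal_mult R a d - formal_mult R b d"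
  by (simp add: formal_mult_def frag_extend_diff)

lemma formal_mult_diff_right: "formal_mult R c (a - b) = formal_mult R c a - formal_mult R c b"
  using formal_mult_add_right [of R c "a - b" b] by (simp add: algebra_simps)

lemma formal_mult_sum_frag_of:
  assumes "finite I" "finite J"
  shows "formal_mult R (\<Sum>i\<in>I. frag_of (f i)) (\<Sum>j\<in>J. frag_of (g j)) =
    (\<Sum>i\<in>I. \<Sum>j\<in>J. frag_of (map2 (\<otimes>\<^bsub>R\<^esub>) (f i) (g j)))"
  using assms by (simp add: formal_mult_def frag_extend_sum comp_def)

lemma tuples_update [simp]:
  "\<lbrakk>xs \<in> tuples R n; a \<in> carrier R\<rbrakk> \<Longrightarrow> xs[i := a] \<in> tuples R n"
  using set_update_subset_insert by (fastforce simp: tuples_def)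

lemma tuples_nth [simp]: "\<lbrakk>xs \<in> tuples R n; i < n\<rbrakk> \<Longrightarrow> xs ! i \<in> carrier R"
  by (auto simp: tuples_def)

lemma map2_update_left:
  "\<lbrakk>length xs = length ys; i < length xs\<rbrakk> \<Longrightarrow>
    map2 f (xs[i := a]) ys = (map2 f xs ys)[i := f a (ys ! i)]"
  by (rule nth_equalityI) (auto simp: nth_list_update)

lemma map2_update_right:
  "\<lbrakk>length xs = length ys; i < length xs\<rbrakk> \<Longrightarrow>
    map2 f xs (ys[i := a]) = (map2 f xs ys)[i := f (xs ! i) a]"
  by (rule nth_equalityI) (auto simp: nth_list_update)

section \<open>Null tensors and their cosets\<close>

context assoc_algebra
begin

lemma tensor_relators_subset: "tensor_relators K R n \<subseteq> carrier (formal_tensors R n)"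
  unfolding tensor_relators_def formal_tensors_def
  by (auto dest!: subsetD [OF keys_diff])

lemma subgroup_null_tensors: "subgroup (null_tensors K R n) (formal_tensors R n)"
  unfolding null_tensors_def
  by (rule group.generate_is_subgroup [OF _ tensor_relators_subset]) (simp add: formal_tensors_def)

lemma null_tensors_carrier: "c \<in> null_tensors K R n \<Longrightarrow> c \<in> carrier (formal_tensors R n)"
  by (rule subgroup.mem_carrier [OF subgroup_null_tensors])

lemma null_tensors_zero [simp]: "0 \<in> null_tensors K R n"
  using subgroup.one_closed [OF subgroup_null_tensors] by (simp add: formal_tensors_def)

lemma null_tensors_add:
  "\<lbrakk>c \<in> null_tensors K R n; d \<in> null_tensors K R n\<rbrakk> \<Longrightarrow> c + d \<in> null_tensors K R n"
  using subgroup.m_closed [OF subgroup_null_tensors] by (simp add: formal_tensors_def)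

lemma null_tensors_uminus: "c \<in> null_tensors K R n \<Longrightarrow> - c \<in> null_tensors K R n"
  using subgroup.m_inv_closed [OF subgroup_null_tensors, of c n] null_tensors_carrier [of c n]
  by (simp add: formal_tensors_def)

lemma null_tensors_diff:
  "\<lbrakk>c \<in> null_tensors K R n; d \<in> null_tensors K R n\<rbrakk> \<Longrightarrow> c - d \<in> null_tensors K R n"
  using null_tensors_add [of c n "- d"] by (simp add: null_tensors_uminus)

text \<open>The operation of \<open>formal_tensors\<close> is plain addition of finitely supported
  functions, so a coset consists of the functions \<open>h + c\<close> with \<open>h\<close> null.
  All later work with cosets goes through such differences.\<close>

lemma mem_tensor_class: "d \<in> tensor_class K R n c \<longleftrightarrow> d - c \<in> null_tensors K R n"
  unfolding tensor_class_def r_coset_def formal_tensors_def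
  by (auto simp: algebra_simps intro: rev_bexI)

lemma tensor_class_eq_iff:
  "tensor_class K R n c = tensor_class K R n d \<longleftrightarrow> c - d \<in> null_tensors K R n"
proof
  assume "tensor_class K R n c = tensor_class K R n d"
  moreover have "c \<in> tensor_class K R n c"
    by (simp add: mem_tensor_class)
  ultimately show "c - d \<in> null_tensors K R n"
    by (simp add: mem_tensor_class)
next
  assume cd: "c - d \<in> null_tensors K R n"
  have "x - c \<in> null_tensors K R n \<longleftrightarrow> x - d \<in> null_tensors K R n" for x
    using null_tensors_add [OF _ cd, of "x - c"] null_tensors_diff [OF _ cd, of "x - d"]
    by (auto simp: algebra_simps)
  then show "tensor_class K R n c = tensor_class K R n d"
    by (auto simp: mem_tensor_class)
qed

section \<open>Maps that respect the tensor relations\<close>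

lemma tensor_relator_add:
  "\<lbrakk>xs \<in> tuples R n; i < n; a \<in> carrier R; b \<in> carrier R\<rbrakk> \<Longrightarrow>
    frag_of (xs[i := a \<oplus>\<^bsub>R\<^esub> b]) - frag_of (xs[i := a]) - frag_of (xs[i := b]) \<in> null_tensors K R n"
  unfolding null_tensors_def tensor_relators_def
  by (rule generate.incl) blast

lemma tensor_relator_smult:
  "\<lbrakk>xs \<in> tuples R n; i < n; j < n; k \<in> carrier K\<rbrakk> \<Longrightarrow>
    frag_of (xs[i := k \<odot>\<^bsub>R\<^esub> xs ! i]) - frag_of (xs[j := k \<odot>\<^bsub>R\<^esub> xs ! j]) \<in> null_tensors K R n"
  unfolding null_tensors_def tensor_relators_def
  by (rule generate.incl) blast

text \<open>The criterion behind the well-definedness proofs below: an additive map that sends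
  generators into a subgroup sends the generated subgroup there too. The hypotheses
  \<open>add\<close> and \<open>smult\<close> treat the two families of relators. The number of
  slots may change from \<open>n\<close> to \<open>m\<close>, as it does for the three embeddings of
  pairs into triples.\<close>

lemma frag_extend_null_tensors:
  assumes add: "\<And>xs i a b. \<lbrakk>xs \<in> tuples R n; i < n; a \<in> carrier R; b \<in> carrier R\<rbrakk> \<Longrightarrow>
      g (xs[i := a \<oplus>\<^bsub>R\<^esub> b]) - g (xs[i := a]) - g (xs[i := b]) \<in> null_tensors K R m"
    and smult: "\<And>xs i j k. \<lbrakk>xs \<in> tuples R n; i < n; j < n; k \<in> carrier K\<rbrakk> \<Longrightarrow>
      g (xs[i := k \<odot>\<^bsub>R\<^esub> xs ! i]) - g (xs[j := k \<odot>\<^bsub>R\<^esub> xs ! j]) \<in> null_tensors K R m"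
    and c: "c \<in> null_tensors K R n"
  shows "frag_extend g c \<in> null_tensors K R m"
proof -
  have rel: "frag_extend g h \<in> null_tensors K R m" if "h \<in> tensor_relators K R n" for h
    using that unfolding tensor_relators_def
    by (auto simp: frag_extend_diff add smult)
  show ?thesis
    using c unfolding null_tensors_def [of K R n]
  proof (induction rule: generate.induct)
    \<comment> \<open>The group inverse of \<open>h\<close> is known to be \<open>- h\<close> once
      the keys of \<open>h\<close> are tuples, so the relator is first placed in the
      carrier.\<close>
    case (inv h)
    then have "Poly_Mapping.keys h \<subseteq> tuples R n"
      using subsetD [OF tensor_relators_subset, of h n] by (simp add: formal_tensors_def)
    then show ?case
      using rel [OF inv] by (simp add: formal_tensors_def frag_extend_minus null_tensors_uminus)
  qed (auto simp: formal_tensors_def frag_extend_add rel null_tensors_add)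
qed

text \<open>Operations on cosets are defined as unions over all representatives. Under the
  hypothesis every member of the union is the same coset, and the union is not empty because
  \<open>c\<close> represents its own class.\<close>

lemma Union_tensor_class:
  assumes "\<And>x. x \<in> null_tensors K R n \<Longrightarrow> g (c + x) - g c \<in> null_tensors K R m"
  shows "(\<Union>d\<in>tensor_class K R n c. tensor_class K R m (g d)) = tensor_class K R m (g c)"
proof -
  have "tensor_class K R m (g d) = tensor_class K R m (g c)" if "d \<in> tensor_class K R n c" for d
    using assms [of "d - c"] that by (simp add: tensor_class_eq_iff mem_tensor_class)
  moreover have "c \<in> tensor_class K R n c"
    by (simp add: mem_tensor_class)
  ultimately show ?thesis
    by blast
qed

text \<open>Each embedding puts the two factors into two slots of a triple and a unit into the
  third. Changing one factor updates only its slot, so a relator of pairs becomes a relator of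
  triples of the same kind.\<close>

lemma place_null_tensors:
  assumes "c \<in> null_tensors K R 2"
  shows "frag_extend (\<lambda>xs. frag_of [xs ! 0, xs ! 1, \<one>\<^bsub>R\<^esub>]) c \<in> null_tensors K R 3"
    and "frag_extend (\<lambda>xs. frag_of [xs ! 0, \<one>\<^bsub>R\<^esub>, xs ! 1]) c \<in> null_tensors K R 3"
    and "frag_extend (\<lambda>xs. frag_of [\<one>\<^bsub>R\<^esub>, xs ! 0, xs ! 1]) c \<in> null_tensors K R 3"
proof -
  have slot: "i = 0 \<or> i = 1" if "i < 2" for i :: nat
    using that by auto
  have len: "length xs = 2" if "xs \<in> tuples R 2" for xs
    using that by (simp add: tuples_def)
  have tup: "[a, b, d] \<in> tuples R 3" if "a \<in> carrier R" "b \<in> carrier R" "d \<in> carrier R" for a b d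
    using that by (simp add: tuples_def)
  \<comment> \<open>One argument serves all three embeddings: \<open>f\<close> builds the triple,
    and \<open>(p, q)\<close> will be (0, 1), (0, 2) and (1, 2).\<close>
  have place: "frag_extend (\<lambda>xs. frag_of (f (xs ! 0) (xs ! 1))) c \<in> null_tensors K R 3"
    if f: "\<And>a b. \<lbrakk>a \<in> carrier R; b \<in> carrier R\<rbrakk> \<Longrightarrow> f a b \<in> tuples R 3"
      and pq: "p < 3" "q < 3"
      and p: "\<And>a b a'. f a' b = (f a b)[p := a']" 
      and q: "\<And>a b b'. f a b' = (f a b)[q := b']"
      and nth: "\<And>a b. f a b ! p = a" "\<And>a b. f a b ! q = b" for f and p q :: nat
  proof (rule frag_extend_null_tensors [OF _ _ assms])
    fix xs a b and i :: nat
    assume *: "xs \<in> tuples R 2" "i < 2" "a \<in> carrier R" "b \<in> carrier R"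
    define z where "z = f (xs ! 0) (xs ! 1)"
    have z: "z \<in> tuples R 3"
      using * by (simp add: z_def f)
    have "f (xs[i := a] ! 0) (xs[i := a] ! 1) = z[if i = 0 then p else q := a]" for a
      using slot [OF *(2)] len [OF *(1)] p [of a "xs ! 1" "xs ! 0"] q [of "xs ! 0" a "xs ! 1"]
      by (auto simp: z_def)
    then show "frag_of (f (xs[i := a \<oplus>\<^bsub>R\<^esub> b] ! 0) (xs[i := a \<oplus>\<^bsub>R\<^esub> b] ! 1)) -
        frag_of (f (xs[i := a] ! 0) (xs[i := a] ! 1)) -
        frag_of (f (xs[i := b] ! 0) (xs[i := b] ! 1)) \<in> null_tensors K R 3"
      using tensor_relator_add [OF z, of "if i = 0 then p else q" a b] * pq by simp
  next
    fix xs k and i j :: nat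
    assume *: "xs \<in> tuples R 2" "i < 2" "j < 2" "k \<in> carrier K"
    define z where "z = f (xs ! 0) (xs ! 1)"
    have z: "z \<in> tuples R 3"
      using * by (simp add: z_def f)
    have "f (xs[i := k \<odot>\<^bsub>R\<^esub> xs ! i] ! 0) (xs[i := k \<odot>\<^bsub>R\<^esub> xs ! i] ! 1) =
        z[if i = 0 then p else q := k \<odot>\<^bsub>R\<^esub> z ! (if i = 0 then p else q)]" if "i < 2" for i
      using slot [OF that] len [OF *(1)] nth
        p [of "k \<odot>\<^bsub>R\<^esub> xs ! 0" "xs ! 1" "xs ! 0"] q [of "xs ! 0" "k \<odot>\<^bsub>R\<^esub> xs ! 1" "xs ! 1"]
      by (auto simp: z_def)
    then show "frag_of (f (xs[i := k \<odot>\<^bsub>R\<^esub> xs ! i] ! 0) (xs[i := k \<odot>\<^bsub>R\<^esub> xs ! i] ! 1)) -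
        frag_of (f (xs[j := k \<odot>\<^bsub>R\<^esub> xs ! j] ! 0) (xs[j := k \<odot>\<^bsub>R\<^esub> xs ! j] ! 1)) \<in> null_tensors K R 3"
      using tensor_relator_smult [OF z, of "if i = 0 then p else q" "if j = 0 then p else q" k] * pq
      by simp
  qed
  show "frag_extend (\<lambda>xs. frag_of [xs ! 0, xs ! 1, \<one>\<^bsub>R\<^esub>]) c \<in> null_tensors K R 3"
    by (rule place [of "\<lambda>a b. [a, b, \<one>\<^bsub>R\<^esub>]" 0 1]) (auto simp: tup)
  show "frag_extend (\<lambda>xs. frag_of [xs ! 0, \<one>\<^bsub>R\<^esub>, xs ! 1]) c \<in> null_tensors K R 3"
    by (rule place [of "\<lambda>a b. [a, \<one>\<^bsub>R\<^esub>, b]" 0 2]) (auto simp: tup)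
  show "frag_extend (\<lambda>xs. frag_of [\<one>\<^bsub>R\<^esub>, xs ! 0, xs ! 1]) c \<in> null_tensors K R 3"
    by (rule place [of "\<lambda>a b. [\<one>\<^bsub>R\<^esub>, a, b]" 1 2]) (auto simp: tup)
qed

lemma place_tensor_class:
  "place12 K R (tensor_class K R 2 c) =
    tensor_class K R 3 (frag_extend (\<lambda>xs. frag_of [xs ! 0, xs ! 1, \<one>\<^bsub>R\<^esub>]) c)"
  "place13 K R (tensor_class K R 2 c) =
    tensor_class K R 3 (frag_extend (\<lambda>xs. frag_of [xs ! 0, \<one>\<^bsub>R\<^esub>, xs ! 1]) c)"
  "place23 K R (tensor_class K R 2 c) =
    tensor_class K R 3 (frag_extend (\<lambda>xs. frag_of [\<one>\<^bsub>R\<^esub>, xs ! 0, xs ! 1]) c)"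
  unfolding place12_def place13_def place23_def
  by (rule Union_tensor_class; simp only: frag_extend_add add_diff_cancel_left' place_null_tensors)+

lemma map2_mult_tuples:
  "\<lbrakk>xs \<in> tuples R n; ys \<in> tuples R n\<rbrakk> \<Longrightarrow> map2 (\<otimes>\<^bsub>R\<^esub>) xs ys \<in> tuples R n"
  by (force simp: tuples_def in_set_zip set_conv_nth)

text \<open>Induction on \<open>d\<close> reduces the claim to right multiplication by one tuple
  \<open>ys\<close>. This turns an update of slot \<open>i\<close> into an update of slot
  \<open>i\<close> of the product, so \<open>l_distr\<close> carries additivity relators to
  additivity relators, and \<open>smult_mult_left\<close> does the same for balancedness.\<close>

lemma formal_mult_null_left:
  assumes c: "c \<in> null_tensors K R n" and d: "d \<in> carrier (formal_tensors R n)"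
  shows "formal_mult R c d \<in> null_tensors K R n"
proof -
  have "Poly_Mapping.keys d \<subseteq> tuples R n"
    using d by (simp add: formal_tensors_def)
  then show ?thesis
  proof (induction d rule: free_Abelian_group_induct [consumes 1])
    case 1
    then show ?case
      using formal_mult_diff_right [of R c 0 0] by simp
  next
    case (2 x y)
    then show ?case
      by (simp add: formal_mult_diff_right null_tensors_diff)
  next
    case (3 ys)
    have "frag_extend (\<lambda>xs. frag_of (map2 (\<otimes>\<^bsub>R\<^esub>) xs ys)) c \<in> null_tensors K R n"
    proof (rule frag_extend_null_tensors [OF _ _ c])
      fix xs i a b
      assume *: "xs \<in> tuples R n" "i < n" "a \<in> carrier R" "b \<in> carrier R"
      then have "length xs = length ys" "i < length xs"
        using 3 by (auto simp: tuples_def)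
      then show "frag_of (map2 (\<otimes>\<^bsub>R\<^esub>) (xs[i := a \<oplus>\<^bsub>R\<^esub> b]) ys) -
          frag_of (map2 (\<otimes>\<^bsub>R\<^esub>) (xs[i := a]) ys) -
          frag_of (map2 (\<otimes>\<^bsub>R\<^esub>) (xs[i := b]) ys) \<in> null_tensors K R n"
        using * 3 tensor_relator_add [OF map2_mult_tuples [OF *(1) 3] *(2),
            of "a \<otimes>\<^bsub>R\<^esub> ys ! i" "b \<otimes>\<^bsub>R\<^esub> ys ! i"]
        by (simp add: map2_update_left l_distr)
    next
      fix xs i j k
      assume *: "xs \<in> tuples R n" "i < n" "j < n" "k \<in> carrier K"
      then have "length xs = length ys" "i < length xs" "j < length xs"
        using 3 by (auto simp: tuples_def)
      then show "frag_of (map2 (\<otimes>\<^bsub>R\<^esub>) (xs[i := k \<odot>\<^bsub>R\<^esub> xs ! i]) ys) -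
          frag_of (map2 (\<otimes>\<^bsub>R\<^esub>) (xs[j := k \<odot>\<^bsub>R\<^esub> xs ! j]) ys) \<in> null_tensors K R n"
        using * 3 tensor_relator_smult [OF map2_mult_tuples [OF *(1) 3] *(2-4)]
        by (simp add: map2_update_left smult_mult_left)
    qed
    then show ?case
      by (simp add: formal_mult_def)
  qed
qed

text \<open>The algebra may be noncommutative, so the other side needs its own argument: induction
  on the left factor, with \<open>r_distr\<close> and \<open>smult_mult_right\<close> in each
  slot.\<close>

lemma formal_mult_null_right:
  assumes d: "d \<in> null_tensors K R n" and c: "c \<in> carrier (formal_tensors R n)"
  shows "formal_mult R c d \<in> null_tensors K R n"
proof -
  have "Poly_Mapping.keys c \<subseteq> tuples R n"
    using c by (simp add: formal_tensors_def)
  then show ?thesis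
  proof (induction c rule: free_Abelian_group_induct [consumes 1])
    case 1
    then show ?case
      by (simp add: formal_mult_def)
  next
    case (2 x y)
    then show ?case
      by (simp add: formal_mult_diff_left null_tensors_diff)
  next
    case (3 xs)
    have "frag_extend (\<lambda>ys. frag_of (map2 (\<otimes>\<^bsub>R\<^esub>) xs ys)) d \<in> null_tensors K R n"
    proof (rule frag_extend_null_tensors [OF _ _ d])
      fix ys i a b
      assume *: "ys \<in> tuples R n" "i < n" "a \<in> carrier R" "b \<in> carrier R"
      then have "length xs = length ys" "i < length xs"
        using 3 by (auto simp: tuples_def)
      then show "frag_of (map2 (\<otimes>\<^bsub>R\<^esub>) xs (ys[i := a \<oplus>\<^bsub>R\<^esub> b])) -
          frag_of (map2 (\<otimes>\<^bsub>R\<^esub>) xs (ys[i := a])) -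
          frag_of (map2 (\<otimes>\<^bsub>R\<^esub>) xs (ys[i := b])) \<in> null_tensors K R n"
        using * 3 tensor_relator_add [OF map2_mult_tuples [OF 3 *(1)] *(2),
            of "xs ! i \<otimes>\<^bsub>R\<^esub> a" "xs ! i \<otimes>\<^bsub>R\<^esub> b"]
        by (simp add: map2_update_right r_distr)
    next
      fix ys i j k
      assume *: "ys \<in> tuples R n" "i < n" "j < n" "k \<in> carrier K"
      then have "length xs = length ys" "i < length xs" "j < length xs"
        using 3 by (auto simp: tuples_def)
      then show "frag_of (map2 (\<otimes>\<^bsub>R\<^esub>) xs (ys[i := k \<odot>\<^bsub>R\<^esub> ys ! i])) -
          frag_of (map2 (\<otimes>\<^bsub>R\<^esub>) xs (ys[j := k \<odot>\<^bsub>R\<^esub> ys ! j])) \<in> null_tensors K R n"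
        using * 3 tensor_relator_smult [OF map2_mult_tuples [OF 3 *(1)] *(2-4)]
        by (simp add: map2_update_right smult_mult_right)
    qed
    then show ?case
      by (simp add: formal_mult_def)
  qed
qed

lemma tensor_power_mult:
  assumes c: "c \<in> carrier (formal_tensors R n)" and d: "d \<in> carrier (formal_tensors R n)"
  shows "tensor_class K R n c \<otimes>\<^bsub>tensor_power K R n\<^esub> tensor_class K R n d =
    tensor_class K R n (formal_mult R c d)"
proof -
  have "tensor_class K R n c \<otimes>\<^bsub>tensor_power K R n\<^esub> tensor_class K R n d =
      (\<Union>c'\<in>tensor_class K R n c. \<Union>d'\<in>tensor_class K R n d. tensor_class K R n (formal_mult R c' d'))"
    by (simp add: tensor_power_def)
  also have "\<dots> = (\<Union>c'\<in>tensor_class K R n c. tensor_class K R n (formal_mult R c' d))"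
  proof (intro SUP_cong refl Union_tensor_class)
    fix c' x
    assume c': "c' \<in> tensor_class K R n c" and x: "x \<in> null_tensors K R n"
    \<comment> \<open>The inner union is collapsed while \<open>c'\<close> runs over all
      representatives of the left factor. Each of them lies in the carrier, as
      \<open>formal_mult_null_right\<close> demands, because it differs from \<open>c\<close> by a
      null tensor.\<close>
    have "c' - c \<in> carrier (formal_tensors R n)"
      using c' by (simp add: mem_tensor_class null_tensors_carrier)
    then have "c' \<in> carrier (formal_tensors R n)"
      using c keys_add [of "c' - c" c] by (auto simp: formal_tensors_def)
    then show "formal_mult R c' (d + x) - formal_mult R c' d \<in> null_tensors K R n"
      by (simp add: formal_mult_add_right formal_mult_null_right x)
  qed
  also have "\<dots> = tensor_class K R n (formal_mult R c d)"
    by (rule Union_tensor_class) (simp add: formal_mult_add_left formal_mult_null_left d)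
  finally show ?thesis .
qed

text \<open>The scalar acts in slot 0, which exists because \<open>n > 0\<close>. An update of
  another slot commutes with this action. In slot 0 itself, additivity follows from distributivity
  of the scalar, and balancedness from the fact that two scalars commute.\<close>

lemma formal_smult_null:
  assumes k: "k \<in> carrier K" and n: "n > 0" and c: "c \<in> null_tensors K R n"
  shows "formal_smult R k c \<in> null_tensors K R n"
  unfolding formal_smult_def
proof (rule frag_extend_null_tensors [OF _ _ c])
  fix xs i a b
  assume *: "xs \<in> tuples R n" "i < n" "a \<in> carrier R" "b \<in> carrier R"
  show "frag_of (xs[i := a \<oplus>\<^bsub>R\<^esub> b, 0 := k \<odot>\<^bsub>R\<^esub> xs[i := a \<oplus>\<^bsub>R\<^esub> b] ! 0]) -
      frag_of (xs[i := a, 0 := k \<odot>\<^bsub>R\<^esub> xs[i := a] ! 0]) -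
      frag_of (xs[i := b, 0 := k \<odot>\<^bsub>R\<^esub> xs[i := b] ! 0]) \<in> null_tensors K R n"
  proof (cases "i = 0")
    case True
    moreover have "length xs > 0"
      using * n by (auto simp: tuples_def)
    ultimately show ?thesis
      using tensor_relator_add [OF *(1,2), of "k \<odot>\<^bsub>R\<^esub> a" "k \<odot>\<^bsub>R\<^esub> b"] * k
      by (simp add: smult_r_distr)
  next
    case False
    then show ?thesis
      using tensor_relator_add [of "xs[0 := k \<odot>\<^bsub>R\<^esub> xs ! 0]" n i a b] * k n
      by (simp add: list_update_swap [of 0])
  qed
next
  fix xs i j k'
  assume *: "xs \<in> tuples R n" "i < n" "j < n" "k' \<in> carrier K"
  define zs where "zs = xs[0 := k \<odot>\<^bsub>R\<^esub> xs ! 0]"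
  have zs: "zs \<in> tuples R n"
    using * k n by (simp add: zs_def)
  have len: "length xs = n"
    using * by (simp add: tuples_def)
  have "xs[i := k' \<odot>\<^bsub>R\<^esub> xs ! i, 0 := k \<odot>\<^bsub>R\<^esub> xs[i := k' \<odot>\<^bsub>R\<^esub> xs ! i] ! 0] = zs[i := k' \<odot>\<^bsub>R\<^esub> zs ! i]"
    if "i < n" for i
  proof (cases "i = 0")
    case True
    \<comment> \<open>Commutativity of \<open>K\<close> enters here: \<open>R.m_comm\<close> comes
      from the \<open>cring\<close> part of the locale \<open>module\<close>, whose prefix
      \<open>R\<close> stands for the ring of scalars.\<close>
    have "k \<odot>\<^bsub>R\<^esub> (k' \<odot>\<^bsub>R\<^esub> xs ! 0) = k' \<odot>\<^bsub>R\<^esub> (k \<odot>\<^bsub>R\<^esub> xs ! 0)"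
      using * k n by (simp flip: smult_assoc1 add: R.m_comm)
    then show ?thesis
      using True n len by (simp add: zs_def)
  next
    case False
    then show ?thesis
      using n len by (simp add: zs_def list_update_swap [of 0])
  qed
  then show "frag_of (xs[i := k' \<odot>\<^bsub>R\<^esub> xs ! i, 0 := k \<odot>\<^bsub>R\<^esub> xs[i := k' \<odot>\<^bsub>R\<^esub> xs ! i] ! 0]) -
      frag_of (xs[j := k' \<odot>\<^bsub>R\<^esub> xs ! j, 0 := k \<odot>\<^bsub>R\<^esub> xs[j := k' \<odot>\<^bsub>R\<^esub> xs ! j] ! 0]) \<in> null_tensors K R n"
    using tensor_relator_smult [OF zs *(2-4)] * by simp
qed

lemma tensor_power_smult:
  assumes "k \<in> carrier K" "n > 0"
  shows "k \<odot>\<^bsub>tensor_power K R n\<^esub> tensor_class K R n c = tensor_class K R n (formal_smult R k c)"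
proof -
  have "formal_smult R k (c + x) - formal_smult R k c \<in> null_tensors K R n"
    if "x \<in> null_tensors K R n" for x
    using formal_smult_null [OF assms that] by (simp add: formal_smult_def frag_extend_add)
  then show ?thesis
    by (simp add: tensor_power_def Union_tensor_class)
qed

section \<open>The additive group of a tensor power\<close>

lemma carrier_tensor_power:
  "carrier (tensor_power K R n) = tensor_class K R n ` carrier (formal_tensors R n)"
  by (auto simp: tensor_power_def FactGroup_def RCOSETS_def tensor_class_def)

lemma tensor_power_add:
  "tensor_class K R n c \<oplus>\<^bsub>tensor_power K R n\<^esub> tensor_class K R n d = tensor_class K R n (c + d)"
proof (intro equalityI subsetI)
  fix x
  assume "x \<in> tensor_class K R n c \<oplus>\<^bsub>tensor_power K R n\<^esub> tensor_class K R n d"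
  then obtain a b where "a \<in> tensor_class K R n c" "b \<in> tensor_class K R n d" "x = a + b"
    by (auto simp: tensor_power_def set_mult_def formal_tensors_def)
  then show "x \<in> tensor_class K R n (c + d)"
    using null_tensors_add [of "a - c" n "b - d"] by (simp add: mem_tensor_class algebra_simps)
next
  fix x
  assume "x \<in> tensor_class K R n (c + d)"
  \<comment> \<open>The sum of two cosets is the set of all sums of representatives; the second
    summand may be taken to be \<open>d\<close> itself.\<close>
  then have "x - d \<in> tensor_class K R n c" "d \<in> tensor_class K R n d"
    by (simp_all add: mem_tensor_class algebra_simps)
  moreover have "x = x - d + d"
    by simp
  ultimately show "x \<in> tensor_class K R n c \<oplus>\<^bsub>tensor_power K R n\<^esub> tensor_class K R n d"
    by (force simp: tensor_power_def set_mult_def formal_tensors_def simp del: diff_add_cancel)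
qed

lemma tensor_power_zero: "\<zero>\<^bsub>tensor_power K R n\<^esub> = tensor_class K R n 0"
  by (auto simp: tensor_power_def FactGroup_def mem_tensor_class)

text \<open>This makes the laws of subtraction and of finite sums available, which turn the
  Yang-Baxter equation and the expansion of \<open>r \<omega>\<close> into statements about
  representatives. The group laws are inherited from addition of representatives.\<close>

lemma abelian_group_tensor_power: "abelian_group (tensor_power K R n)"
proof (rule abelian_groupI)
  fix x
  assume "x \<in> carrier (tensor_power K R n)"
  then obtain c where c: "c \<in> carrier (formal_tensors R n)" and x: "x = tensor_class K R n c"
    by (auto simp: carrier_tensor_power)
  have "tensor_class K R n (- c) \<in> carrier (tensor_power K R n)"
    using c by (simp add: carrier_tensor_power formal_tensors_def)
  then show "\<exists>y\<in>carrier (tensor_power K R n). y \<oplus>\<^bsub>tensor_power K R n\<^esub> x = \<zero>\<^bsub>tensor_power K R n\<^esub>"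
    by (rule rev_bexI) (simp add: x tensor_power_add tensor_power_zero)
next
  fix x y
  assume "x \<in> carrier (tensor_power K R n)" "y \<in> carrier (tensor_power K R n)"
  then obtain c d where "c \<in> carrier (formal_tensors R n)" "d \<in> carrier (formal_tensors R n)"
    and "x = tensor_class K R n c" "y = tensor_class K R n d"
    by (auto simp: carrier_tensor_power)
  moreover from this have "c + d \<in> carrier (formal_tensors R n)"
    using keys_add [of c d] by (auto simp: formal_tensors_def)
  ultimately show "x \<oplus>\<^bsub>tensor_power K R n\<^esub> y \<in> carrier (tensor_power K R n)"
    by (simp add: tensor_power_add carrier_tensor_power)
next
  show "\<zero>\<^bsub>tensor_power K R n\<^esub> \<in> carrier (tensor_power K R n)"
    by (simp add: carrier_tensor_power tensor_power_zero formal_tensors_def)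
qed (auto simp: carrier_tensor_power tensor_power_add tensor_power_zero ac_simps)

lemma tensor_power_minus:
  assumes "c \<in> carrier (formal_tensors R n)" "d \<in> carrier (formal_tensors R n)"
  shows "tensor_class K R n c \<ominus>\<^bsub>tensor_power K R n\<^esub> tensor_class K R n d = tensor_class K R n (c - d)"
proof -
  interpret T: abelian_group "tensor_power K R n"
    by (rule abelian_group_tensor_power)
  have "\<ominus>\<^bsub>tensor_power K R n\<^esub> tensor_class K R n d = tensor_class K R n (- d)"
    by (rule T.minus_equality)
      (use assms in \<open>simp_all add: tensor_power_add tensor_power_zero carrier_tensor_power formal_tensors_def\<close>)
  then show ?thesis
    by (simp add: a_minus_def tensor_power_add)
qed

lemma finsum_tensor_class:
  assumes "finite A" "\<And>i. i \<in> A \<Longrightarrow> c i \<in> carrier (formal_tensors R n)"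
  shows "(\<Oplus>\<^bsub>tensor_power K R n\<^esub> i\<in>A. tensor_class K R n (c i)) = tensor_class K R n (\<Sum>i\<in>A. c i)"
proof -
  interpret T: abelian_group "tensor_power K R n"
    by (rule abelian_group_tensor_power)
  show ?thesis
    using assms
    by (induction A rule: finite_induct)
      (auto simp: tensor_power_zero tensor_power_add carrier_tensor_power Pi_def)
qed

section \<open>Finite sums of pure tensors and their evaluation in the algebra\<close>

lemma sum_frag_of_carrier:
  "(\<And>i. i \<in> A \<Longrightarrow> z i \<in> tuples R n) \<Longrightarrow> (\<Sum>i\<in>A. frag_of (z i)) \<in> carrier (formal_tensors R n)"
  unfolding formal_tensors_def by (rule sum_closed_free_Abelian_group) simp

lemma double_sum_frag_of_carrier:
  assumes "\<And>i j. \<lbrakk>i \<in> A; j \<in> B\<rbrakk> \<Longrightarrow> z i j \<in> tuples R n"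
  shows "(\<Sum>i\<in>A. \<Sum>j\<in>B. frag_of (z i j)) \<in> carrier (formal_tensors R n)"
  unfolding formal_tensors_def
  by (intro sum_closed_free_Abelian_group) (use assms in simp)

lemma place_sum:
  assumes "finite I"
  shows "place12 K R (tensor_class K R 2 (\<Sum>i\<in>I. frag_of [u i, v i])) =
      tensor_class K R 3 (\<Sum>i\<in>I. frag_of [u i, v i, \<one>\<^bsub>R\<^esub>])"
    and "place13 K R (tensor_class K R 2 (\<Sum>i\<in>I. frag_of [u i, v i])) =
      tensor_class K R 3 (\<Sum>i\<in>I. frag_of [u i, \<one>\<^bsub>R\<^esub>, v i])"
    and "place23 K R (tensor_class K R 2 (\<Sum>i\<in>I. frag_of [u i, v i])) =
      tensor_class K R 3 (\<Sum>i\<in>I. frag_of [\<one>\<^bsub>R\<^esub>, u i, v i])"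
  using assms by (simp_all add: place_tensor_class frag_extend_sum comp_def)

lemma tensor_power_mult_sum:
  assumes "finite I" "\<And>i. i \<in> I \<Longrightarrow> f i \<in> tuples R n"
    and "finite J" "\<And>j. j \<in> J \<Longrightarrow> g j \<in> tuples R n"
  shows "tensor_class K R n (\<Sum>i\<in>I. frag_of (f i)) \<otimes>\<^bsub>tensor_power K R n\<^esub>
      tensor_class K R n (\<Sum>j\<in>J. frag_of (g j)) =
    tensor_class K R n (\<Sum>i\<in>I. \<Sum>j\<in>J. frag_of (map2 (\<otimes>\<^bsub>R\<^esub>) (f i) (g j)))"
  using assms by (simp add: tensor_power_mult sum_frag_of_carrier formal_mult_sum_frag_of)

text \<open>The universal property of the tensor power, for additive maps into \<open>R\<close>. The
  extension from the free abelian group kills both families of relators, and its kernel is a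
  subgroup, so it kills all null tensors. The condition on scalars only compares slots, as the
  relators do.\<close>

lemma multilinear_extension:
  assumes f: "f ` tuples R n \<subseteq> carrier R"
    and add: "\<And>xs i a b. \<lbrakk>xs \<in> tuples R n; i < n; a \<in> carrier R; b \<in> carrier R\<rbrakk> \<Longrightarrow>
      f (xs[i := a \<oplus>\<^bsub>R\<^esub> b]) = f (xs[i := a]) \<oplus>\<^bsub>R\<^esub> f (xs[i := b])"
    and smult: "\<And>xs i j k. \<lbrakk>xs \<in> tuples R n; i < n; j < n; k \<in> carrier K\<rbrakk> \<Longrightarrow>
      f (xs[i := k \<odot>\<^bsub>R\<^esub> xs ! i]) = f (xs[j := k \<odot>\<^bsub>R\<^esub> xs ! j])"
  obtains h where "h \<in> hom (formal_tensors R n) (add_monoid R)"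
    and "\<And>xs. xs \<in> tuples R n \<Longrightarrow> h (frag_of xs) = f xs"
    and "\<And>c. c \<in> null_tensors K R n \<Longrightarrow> h c = \<zero>\<^bsub>R\<^esub>"
proof -
  obtain h where h: "h \<in> hom (formal_tensors R n) (add_monoid R)"
    and h_of: "\<And>xs. xs \<in> tuples R n \<Longrightarrow> h (frag_of xs) = f xs"
    using comm_group.free_Abelian_group_universal [OF M.a_comm_group, of f "tuples R n"] f
    by (auto simp: formal_tensors_def)
  interpret h: group_hom "formal_tensors R n" "add_monoid R" h
    by (simp add: group_hom_def group_hom_axioms_def h [unfolded formal_tensors_def] M.a_group formal_tensors_def)
  have diff: "h (c - d) = h c \<ominus>\<^bsub>R\<^esub> h d"
    if "c \<in> carrier (formal_tensors R n)" "d \<in> carrier (formal_tensors R n)" for c d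
    using h.hom_mult [of c "inv\<^bsub>formal_tensors R n\<^esub> d"] h.hom_inv [of d] that
    by (simp add: formal_tensors_def a_minus_def a_inv_def)
  have "tensor_relators K R n \<subseteq> kernel (formal_tensors R n) (add_monoid R) h"
  proof
    fix c
    assume c: "c \<in> tensor_relators K R n"
    then have "c \<in> carrier (formal_tensors R n)"
      using tensor_relators_subset by blast
    moreover from c have "h c = \<zero>\<^bsub>R\<^esub>"
      unfolding tensor_relators_def
    proof (elim UnE; clarify)
      fix xs i a b
      assume *: "xs \<in> tuples R n" "i < n" "a \<in> carrier R" "b \<in> carrier R"
      \<comment> \<open>Regrouping puts \<open>p\<close> and \<open>q\<close> next to their
        negatives; with \<open>p\<close> and \<open>q\<close> the values of \<open>f\<close> at the
        two updated tuples, this makes the image of an additivity relator vanish.\<close>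
      have "p \<oplus>\<^bsub>R\<^esub> q \<ominus>\<^bsub>R\<^esub> p \<ominus>\<^bsub>R\<^esub> q = (p \<oplus>\<^bsub>R\<^esub> \<ominus>\<^bsub>R\<^esub> p) \<oplus>\<^bsub>R\<^esub> (q \<oplus>\<^bsub>R\<^esub> \<ominus>\<^bsub>R\<^esub> q)"
        if "p \<in> carrier R" "q \<in> carrier R" for p q
        using that by (simp add: a_minus_def M.a_ac del: M.r_neg)
      moreover have "f (xs[i := a]) \<in> carrier R" "f (xs[i := b]) \<in> carrier R"
        using f * by (auto simp: image_subset_iff)
      moreover have "frag_of (xs[i := a \<oplus>\<^bsub>R\<^esub> b]) - frag_of (xs[i := a]) \<in> carrier (formal_tensors R n)"
        using * by (auto simp: formal_tensors_def dest!: subsetD [OF keys_diff])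
      ultimately show "h (frag_of (xs[i := a \<oplus>\<^bsub>R\<^esub> b]) - frag_of (xs[i := a]) - frag_of (xs[i := b])) = \<zero>\<^bsub>R\<^esub>"
        using * by (simp add: diff formal_tensors_def h_of add M.r_neg)
    next
      fix xs i j k
      assume *: "xs \<in> tuples R n" "i < n" "j < n" "k \<in> carrier K"
      then have "f (xs[j := k \<odot>\<^bsub>R\<^esub> xs ! j]) \<in> carrier R"
        using f by (auto simp: image_subset_iff)
      then show "h (frag_of (xs[i := k \<odot>\<^bsub>R\<^esub> xs ! i]) - frag_of (xs[j := k \<odot>\<^bsub>R\<^esub> xs ! j])) = \<zero>\<^bsub>R\<^esub>"
        using * by (simp add: diff formal_tensors_def h_of smult [OF *] a_minus_def M.r_neg)
    qed
    ultimately show "c \<in> kernel (formal_tensors R n) (add_monoid R) h"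
      by (simp add: kernel_def)
  qed
  then have "null_tensors K R n \<subseteq> kernel (formal_tensors R n) (add_monoid R) h"
    unfolding null_tensors_def
    by (rule group.generate_subgroup_incl [OF h.G.is_group _ h.subgroup_kernel])
  then show thesis
    using that [OF h h_of] by (auto simp: kernel_def)
qed

text \<open>The last property transfers equations between cosets to equations in \<open>R\<close>.
  Since \<open>h\<close> is additive on the carrier, it is applied to
  \<open>c = (c - d) + d\<close>, where \<open>c - d\<close> is null and \<open>d\<close> is assumed
  to be in the carrier.\<close>

lemma sandwich_evaluation:
  assumes x: "x \<in> carrier R" and y: "y \<in> carrier R"
  obtains h where "h \<in> hom (formal_tensors R 3) (add_monoid R)"
    and "\<And>a b c. \<lbrakk>a \<in> carrier R; b \<in> carrier R; c \<in> carrier R\<rbrakk> \<Longrightarrow>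
      h (frag_of [a, b, c]) = a \<otimes>\<^bsub>R\<^esub> x \<otimes>\<^bsub>R\<^esub> b \<otimes>\<^bsub>R\<^esub> y \<otimes>\<^bsub>R\<^esub> c"
    and "\<And>c d. \<lbrakk>tensor_class K R 3 c = tensor_class K R 3 d; d \<in> carrier (formal_tensors R 3)\<rbrakk> \<Longrightarrow>
      h c = h d"
proof -
  define f where "f xs = xs ! 0 \<otimes>\<^bsub>R\<^esub> x \<otimes>\<^bsub>R\<^esub> xs ! 1 \<otimes>\<^bsub>R\<^esub> y \<otimes>\<^bsub>R\<^esub> xs ! 2" for xs
  have slot: "i = 0 \<or> i = 1 \<or> i = 2" if "i < 3" for i :: nat
    using that by auto
  have nth: "length xs = 3 \<and> xs ! 0 \<in> carrier R \<and> xs ! Suc 0 \<in> carrier R \<and> xs ! 2 \<in> carrier R"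
    if "xs \<in> tuples R 3" for xs
    using that by (auto simp: tuples_def)
  \<comment> \<open>A scalar can be pulled out of any of the three slots. Both sides of the
    balancedness condition thus become \<open>k\<close> times \<open>f xs\<close>.\<close>
  have smult: "f (xs[i := k \<odot>\<^bsub>R\<^esub> xs ! i]) = k \<odot>\<^bsub>R\<^esub> f xs"
    if "xs \<in> tuples R 3" "i < 3" "k \<in> carrier K" for xs i k
    using slot [OF that(2)] nth [OF that(1)] that(3) x y
    by (elim disjE) (simp_all add: f_def smult_mult_left smult_mult_right)
  show thesis
  proof (rule multilinear_extension [of f 3])
    show "f ` tuples R 3 \<subseteq> carrier R"
      using nth x y by (auto simp: f_def)
  next
    fix xs a b and i :: nat
    assume *: "xs \<in> tuples R 3" "i < 3" "a \<in> carrier R" "b \<in> carrier R"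
    show "f (xs[i := a \<oplus>\<^bsub>R\<^esub> b]) = f (xs[i := a]) \<oplus>\<^bsub>R\<^esub> f (xs[i := b])"
      using slot [OF *(2)] nth [OF *(1)] *(3,4) x y
      by (elim disjE) (simp_all add: f_def l_distr r_distr)
  next
    fix h
    assume h: "h \<in> hom (formal_tensors R 3) (add_monoid R)"
      and h_of: "\<And>xs. xs \<in> tuples R 3 \<Longrightarrow> h (frag_of xs) = f xs"
      and null: "\<And>c. c \<in> null_tensors K R 3 \<Longrightarrow> h c = \<zero>\<^bsub>R\<^esub>"
    have "h (frag_of [a, b, c]) = a \<otimes>\<^bsub>R\<^esub> x \<otimes>\<^bsub>R\<^esub> b \<otimes>\<^bsub>R\<^esub> y \<otimes>\<^bsub>R\<^esub> c"
      if "a \<in> carrier R" "b \<in> carrier R" "c \<in> carrier R" for a b c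
      using that by (subst h_of) (auto simp: tuples_def f_def)
    moreover have "h c = h d"
      if "tensor_class K R 3 c = tensor_class K R 3 d" "d \<in> carrier (formal_tensors R 3)" for c d
    proof -
      have cd: "c - d \<in> null_tensors K R 3"
        using that by (simp add: tensor_class_eq_iff)
      then show ?thesis
        using hom_mult [OF h null_tensors_carrier [OF cd] that(2)] hom_in_carrier [OF h that(2)] null [OF cd]
        by (simp add: formal_tensors_def)
    qed
    ultimately show thesis
      using that [OF h] by blast
  qed (simp add: smult)
qed

lemma hom_formal_tensors_sum:
  assumes h: "h \<in> hom (formal_tensors R n) (add_monoid R)"
    and "finite A" "\<And>i. i \<in> A \<Longrightarrow> c i \<in> carrier (formal_tensors R n)"
  shows "h (\<Sum>i\<in>A. c i) = (\<Oplus>\<^bsub>R\<^esub> i\<in>A. h (c i))"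
  using assms(2,3)
proof (induction A rule: finite_induct)
  case empty
  then show ?case
    using hom_one [OF h _ M.a_group] by (simp add: formal_tensors_def)
next
  case (insert i A)
  have "(\<Sum>i\<in>A. c i) \<in> carrier (formal_tensors R n)"
    unfolding formal_tensors_def
    by (rule sum_closed_free_Abelian_group) (use insert in \<open>simp add: formal_tensors_def\<close>)
  then have "h (c i + (\<Sum>i\<in>A. c i)) = h (c i) \<oplus>\<^bsub>R\<^esub> h (\<Sum>i\<in>A. c i)"
    using hom_mult [OF h, of "c i"] insert by (simp add: formal_tensors_def)
  moreover have "h (c j) \<in> carrier R" if "j \<in> insert i A" for j
    using hom_in_carrier [OF h insert.prems [OF that]] by simp
  ultimately show ?case
    using insert by (simp add: Pi_def)
qed

lemma hom_formal_tensors_double_sum: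
  assumes h: "h \<in> hom (formal_tensors R n) (add_monoid R)"
    and "finite A" "finite B"
    and z: "\<And>i j. \<lbrakk>i \<in> A; j \<in> B\<rbrakk> \<Longrightarrow> z i j \<in> tuples R n"
  shows "h (\<Sum>i\<in>A. \<Sum>j\<in>B. frag_of (z i j)) = (\<Oplus>\<^bsub>R\<^esub> i\<in>A. \<Oplus>\<^bsub>R\<^esub> j\<in>B. h (frag_of (z i j)))"
proof -
  have closed: "(\<Sum>j\<in>B. frag_of (z i j)) \<in> carrier (formal_tensors R n)" if "i \<in> A" for i
    by (rule sum_frag_of_carrier) (use z that in simp)
  have frag: "frag_of (z i j) \<in> carrier (formal_tensors R n)" if "i \<in> A" "j \<in> B" for i j
    using z that by (simp add: formal_tensors_def)
  have "h (\<Sum>i\<in>A. \<Sum>j\<in>B. frag_of (z i j)) = (\<Oplus>\<^bsub>R\<^esub> i\<in>A. h (\<Sum>j\<in>B. frag_of (z i j)))"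
    by (rule hom_formal_tensors_sum [OF h \<open>finite A\<close> closed])
  also have "\<dots> = (\<Oplus>\<^bsub>R\<^esub> i\<in>A. \<Oplus>\<^bsub>R\<^esub> j\<in>B. h (frag_of (z i j)))"
  proof (rule M.finsum_cong')
    show "h (\<Sum>j\<in>B. frag_of (z i j)) = (\<Oplus>\<^bsub>R\<^esub> j\<in>B. h (frag_of (z i j)))" if "i \<in> A" for i
      by (rule hom_formal_tensors_sum [OF h \<open>finite B\<close> frag [OF that]])
    show "(\<lambda>i. \<Oplus>\<^bsub>R\<^esub> j\<in>B. h (frag_of (z i j))) \<in> A \<rightarrow> carrier R"
      using hom_in_carrier [OF h frag] by (auto intro!: M.finsum_closed)
  qed simp
  finally show ?thesis .
qed

section \<open>Sandwich operators and their compositions\<close>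

lemma linear_operator_sandwich:
  assumes "finite I" "\<And>i. i \<in> I \<Longrightarrow> u i \<in> carrier R" "\<And>i. i \<in> I \<Longrightarrow> v i \<in> carrier R"
  shows "linear_operator K R (\<lambda>x. \<Oplus>\<^bsub>R\<^esub> i\<in>I. u i \<otimes>\<^bsub>R\<^esub> x \<otimes>\<^bsub>R\<^esub> v i)"
  unfolding linear_operator_def
proof (intro conjI ballI)
  show "(\<lambda>x. \<Oplus>\<^bsub>R\<^esub> i\<in>I. u i \<otimes>\<^bsub>R\<^esub> x \<otimes>\<^bsub>R\<^esub> v i) \<in> carrier R \<rightarrow> carrier R"
    using assms by (auto intro!: M.finsum_closed)
next
  fix x y
  assume "x \<in> carrier R" "y \<in> carrier R"
  then show "(\<Oplus>\<^bsub>R\<^esub> i\<in>I. u i \<otimes>\<^bsub>R\<^esub> (x \<oplus>\<^bsub>R\<^esub> y) \<otimes>\<^bsub>R\<^esub> v i) =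
      (\<Oplus>\<^bsub>R\<^esub> i\<in>I. u i \<otimes>\<^bsub>R\<^esub> x \<otimes>\<^bsub>R\<^esub> v i) \<oplus>\<^bsub>R\<^esub> (\<Oplus>\<^bsub>R\<^esub> i\<in>I. u i \<otimes>\<^bsub>R\<^esub> y \<otimes>\<^bsub>R\<^esub> v i)"
    using assms by (subst M.finsum_addf [symmetric]) (auto simp del: M.finsum_addf intro!: M.finsum_cong' simp: l_distr r_distr)
next
  fix k x
  assume "k \<in> carrier K" "x \<in> carrier R"
  then show "(\<Oplus>\<^bsub>R\<^esub> i\<in>I. u i \<otimes>\<^bsub>R\<^esub> (k \<odot>\<^bsub>R\<^esub> x) \<otimes>\<^bsub>R\<^esub> v i) =
      k \<odot>\<^bsub>R\<^esub> (\<Oplus>\<^bsub>R\<^esub> i\<in>I. u i \<otimes>\<^bsub>R\<^esub> x \<otimes>\<^bsub>R\<^esub> v i)"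
    using assms
    by (subst finsum_smult_ldistr)
      (auto intro!: M.finsum_cong' simp: smult_mult_left smult_mult_right)
qed

text \<open>The free factors \<open>y\<close> and \<open>z\<close> around the inner operator let one
  expansion cover both nested terms of the Rota-Baxter equation: setting one of them to the unit
  gives the form \<open>P (Q x y)\<close> or \<open>Q (x P y)\<close>.\<close>

lemma sandwich_sandwich:
  assumes "finite I" "\<And>i. i \<in> I \<Longrightarrow> u i \<in> carrier R" "\<And>i. i \<in> I \<Longrightarrow> v i \<in> carrier R"
    and "finite J" "\<And>j. j \<in> J \<Longrightarrow> u' j \<in> carrier R" "\<And>j. j \<in> J \<Longrightarrow> v' j \<in> carrier R"
    and "x \<in> carrier R" "y \<in> carrier R" "z \<in> carrier R"
  shows "(\<Oplus>\<^bsub>R\<^esub> i\<in>I. u i \<otimes>\<^bsub>R\<^esub> (y \<otimes>\<^bsub>R\<^esub> (\<Oplus>\<^bsub>R\<^esub> j\<in>J. u' j \<otimes>\<^bsub>R\<^esub> x \<otimes>\<^bsub>R\<^esub> v' j) \<otimes>\<^bsub>R\<^esub> z) \<otimes>\<^bsub>R\<^esub> v i) =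
    (\<Oplus>\<^bsub>R\<^esub> i\<in>I. \<Oplus>\<^bsub>R\<^esub> j\<in>J. u i \<otimes>\<^bsub>R\<^esub> (y \<otimes>\<^bsub>R\<^esub> (u' j \<otimes>\<^bsub>R\<^esub> x \<otimes>\<^bsub>R\<^esub> v' j) \<otimes>\<^bsub>R\<^esub> z) \<otimes>\<^bsub>R\<^esub> v i)"
proof (rule M.finsum_cong')
  fix i
  assume "i \<in> I"
  then show "u i \<otimes>\<^bsub>R\<^esub> (y \<otimes>\<^bsub>R\<^esub> (\<Oplus>\<^bsub>R\<^esub> j\<in>J. u' j \<otimes>\<^bsub>R\<^esub> x \<otimes>\<^bsub>R\<^esub> v' j) \<otimes>\<^bsub>R\<^esub> z) \<otimes>\<^bsub>R\<^esub> v i =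
      (\<Oplus>\<^bsub>R\<^esub> j\<in>J. u i \<otimes>\<^bsub>R\<^esub> (y \<otimes>\<^bsub>R\<^esub> (u' j \<otimes>\<^bsub>R\<^esub> x \<otimes>\<^bsub>R\<^esub> v' j) \<otimes>\<^bsub>R\<^esub> z) \<otimes>\<^bsub>R\<^esub> v i)"
    using assms by (simp add: finsum_ldistr finsum_rdistr Pi_def)
qed (use assms in \<open>auto intro!: M.finsum_closed\<close>)

lemma sandwich_mult_sandwich:
  assumes "finite I" "\<And>i. i \<in> I \<Longrightarrow> u i \<in> carrier R" "\<And>i. i \<in> I \<Longrightarrow> v i \<in> carrier R"
    and "finite J" "\<And>j. j \<in> J \<Longrightarrow> u' j \<in> carrier R" "\<And>j. j \<in> J \<Longrightarrow> v' j \<in> carrier R"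
    and "x \<in> carrier R" "y \<in> carrier R"
  shows "(\<Oplus>\<^bsub>R\<^esub> i\<in>I. u i \<otimes>\<^bsub>R\<^esub> x \<otimes>\<^bsub>R\<^esub> v i) \<otimes>\<^bsub>R\<^esub> (\<Oplus>\<^bsub>R\<^esub> j\<in>J. u' j \<otimes>\<^bsub>R\<^esub> y \<otimes>\<^bsub>R\<^esub> v' j) =
    (\<Oplus>\<^bsub>R\<^esub> i\<in>I. \<Oplus>\<^bsub>R\<^esub> j\<in>J. (u i \<otimes>\<^bsub>R\<^esub> x \<otimes>\<^bsub>R\<^esub> v i) \<otimes>\<^bsub>R\<^esub> (u' j \<otimes>\<^bsub>R\<^esub> y \<otimes>\<^bsub>R\<^esub> v' j))"
  using assms
  by (subst finsum_ldistr) (auto intro!: M.finsum_cong' M.finsum_closed simp: finsum_rdistr Pi_def)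

text \<open>The unit factors are those left by slotwise multiplication of the representatives of
  \<open>r\<^sub>1\<^sub>2\<close> and \<open>s\<^sub>2\<^sub>3\<close>. After evaluation,
  associativity splits each term as \<open>(u x v) (u' y v')\<close>. The result serves both the
  exchange hypothesis and the Yang-Baxter equation.\<close>

lemma place12_place23_evaluation:
  assumes I: "finite I" "\<And>i. i \<in> I \<Longrightarrow> u i \<in> carrier R" "\<And>i. i \<in> I \<Longrightarrow> v i \<in> carrier R"
    and J: "finite J" "\<And>j. j \<in> J \<Longrightarrow> u' j \<in> carrier R" "\<And>j. j \<in> J \<Longrightarrow> v' j \<in> carrier R"
    and xy: "x \<in> carrier R" "y \<in> carrier R"
    and h: "h \<in> hom (formal_tensors R 3) (add_monoid R)"
    and h_of: "\<And>a b c. \<lbrakk>a \<in> carrier R; b \<in> carrier R; c \<in> carrier R\<rbrakk> \<Longrightarrow>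
      h (frag_of [a, b, c]) = a \<otimes>\<^bsub>R\<^esub> x \<otimes>\<^bsub>R\<^esub> b \<otimes>\<^bsub>R\<^esub> y \<otimes>\<^bsub>R\<^esub> c"
  shows "h (\<Sum>i\<in>I. \<Sum>j\<in>J. frag_of [u i \<otimes>\<^bsub>R\<^esub> \<one>\<^bsub>R\<^esub>, v i \<otimes>\<^bsub>R\<^esub> u' j, \<one>\<^bsub>R\<^esub> \<otimes>\<^bsub>R\<^esub> v' j]) =
    (\<Oplus>\<^bsub>R\<^esub> i\<in>I. u i \<otimes>\<^bsub>R\<^esub> x \<otimes>\<^bsub>R\<^esub> v i) \<otimes>\<^bsub>R\<^esub> (\<Oplus>\<^bsub>R\<^esub> j\<in>J. u' j \<otimes>\<^bsub>R\<^esub> y \<otimes>\<^bsub>R\<^esub> v' j)"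
proof -
  have "h (\<Sum>i\<in>I. \<Sum>j\<in>J. frag_of [u i \<otimes>\<^bsub>R\<^esub> \<one>\<^bsub>R\<^esub>, v i \<otimes>\<^bsub>R\<^esub> u' j, \<one>\<^bsub>R\<^esub> \<otimes>\<^bsub>R\<^esub> v' j]) =
      (\<Oplus>\<^bsub>R\<^esub> i\<in>I. \<Oplus>\<^bsub>R\<^esub> j\<in>J. (u i \<otimes>\<^bsub>R\<^esub> x \<otimes>\<^bsub>R\<^esub> v i) \<otimes>\<^bsub>R\<^esub> (u' j \<otimes>\<^bsub>R\<^esub> y \<otimes>\<^bsub>R\<^esub> v' j))"
    by (subst hom_formal_tensors_double_sum [OF h I(1) J(1)], use I J in \<open>simp add: tuples_def\<close>)
      (use I J xy in \<open>auto simp: h_of m_assoc intro!: M.finsum_cong' M.finsum_closed\<close>)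
  then show ?thesis
    by (simp only: sandwich_mult_sandwich [OF I J xy])
qed

section \<open>Operator identities from tensor equations\<close>

lemma sandwich_mult_commute:
  assumes I: "finite I" "\<And>i. i \<in> I \<Longrightarrow> u i \<in> carrier R" "\<And>i. i \<in> I \<Longrightarrow> v i \<in> carrier R"
    and J: "finite J" "\<And>j. j \<in> J \<Longrightarrow> u' j \<in> carrier R" "\<And>j. j \<in> J \<Longrightarrow> v' j \<in> carrier R"
    and r: "r = tensor_class K R 2 (\<Sum>i\<in>I. frag_of [u i, v i])"
    and s: "s = tensor_class K R 2 (\<Sum>j\<in>J. frag_of [u' j, v' j])"
    and rs: "place12 K R r \<otimes>\<^bsub>tensor_power K R 3\<^esub> place23 K R s =
      place12 K R s \<otimes>\<^bsub>tensor_power K R 3\<^esub> place23 K R r"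
    and xy: "x \<in> carrier R" "y \<in> carrier R"
  shows "(\<Oplus>\<^bsub>R\<^esub> i\<in>I. u i \<otimes>\<^bsub>R\<^esub> x \<otimes>\<^bsub>R\<^esub> v i) \<otimes>\<^bsub>R\<^esub> (\<Oplus>\<^bsub>R\<^esub> j\<in>J. u' j \<otimes>\<^bsub>R\<^esub> y \<otimes>\<^bsub>R\<^esub> v' j) =
    (\<Oplus>\<^bsub>R\<^esub> j\<in>J. u' j \<otimes>\<^bsub>R\<^esub> x \<otimes>\<^bsub>R\<^esub> v' j) \<otimes>\<^bsub>R\<^esub> (\<Oplus>\<^bsub>R\<^esub> i\<in>I. u i \<otimes>\<^bsub>R\<^esub> y \<otimes>\<^bsub>R\<^esub> v i)"
proof -
  obtain h where h: "h \<in> hom (formal_tensors R 3) (add_monoid R)"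
    and h_of: "\<And>a b c. \<lbrakk>a \<in> carrier R; b \<in> carrier R; c \<in> carrier R\<rbrakk> \<Longrightarrow>
      h (frag_of [a, b, c]) = a \<otimes>\<^bsub>R\<^esub> x \<otimes>\<^bsub>R\<^esub> b \<otimes>\<^bsub>R\<^esub> y \<otimes>\<^bsub>R\<^esub> c"
    and h_eq: "\<And>c d. \<lbrakk>tensor_class K R 3 c = tensor_class K R 3 d; d \<in> carrier (formal_tensors R 3)\<rbrakk> \<Longrightarrow>
      h c = h d"
    using sandwich_evaluation [OF xy] by blast
  \<comment> \<open>\<open>?c\<close> and \<open>?d\<close> represent
    \<open>r\<^sub>1\<^sub>2 s\<^sub>2\<^sub>3\<close> and
    \<open>s\<^sub>1\<^sub>2 r\<^sub>2\<^sub>3\<close>.\<close>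
  let ?c = "\<Sum>i\<in>I. \<Sum>j\<in>J. frag_of [u i \<otimes>\<^bsub>R\<^esub> \<one>\<^bsub>R\<^esub>, v i \<otimes>\<^bsub>R\<^esub> u' j, \<one>\<^bsub>R\<^esub> \<otimes>\<^bsub>R\<^esub> v' j]"
  let ?d = "\<Sum>j\<in>J. \<Sum>i\<in>I. frag_of [u' j \<otimes>\<^bsub>R\<^esub> \<one>\<^bsub>R\<^esub>, v' j \<otimes>\<^bsub>R\<^esub> u i, \<one>\<^bsub>R\<^esub> \<otimes>\<^bsub>R\<^esub> v i]"
  have "tensor_class K R 3 ?c = tensor_class K R 3 ?d"
    using rs I J by (simp add: r s place_sum tensor_power_mult_sum tuples_def)
  moreover have "?d \<in> carrier (formal_tensors R 3)"
    using I J by (intro double_sum_frag_of_carrier) (simp add: tuples_def)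
  ultimately have "h ?c = h ?d"
    by (rule h_eq)
  then show ?thesis
    using place12_place23_evaluation [OF I J xy h h_of] place12_place23_evaluation [OF J I xy h h_of]
    by simp
qed

text \<open>Evaluating the four terms of the equation at \<open>x\<close> and \<open>y\<close> gives
  the identity. Its right-hand side is that of the matching equation for \<open>Q\<close> followed
  by \<open>P\<close>, but the product on the left has its factors in the opposite order;
  \<open>sandwich_mult_commute\<close> repairs this in the theorem.\<close>

lemma AYBE_sandwich:
  assumes I: "finite I" "\<And>i. i \<in> I \<Longrightarrow> u i \<in> carrier R" "\<And>i. i \<in> I \<Longrightarrow> v i \<in> carrier R"
    and J: "finite J" "\<And>j. j \<in> J \<Longrightarrow> u' j \<in> carrier R" "\<And>j. j \<in> J \<Longrightarrow> v' j \<in> carrier R"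
    and r: "r = tensor_class K R 2 (\<Sum>i\<in>I. frag_of [u i, v i])"
    and s: "s = tensor_class K R 2 (\<Sum>j\<in>J. frag_of [u' j, v' j])"
    and l: "l \<in> carrier K"
    and rs: "((place13 K R r \<otimes>\<^bsub>tensor_power K R 3\<^esub> place12 K R s)
        \<ominus>\<^bsub>tensor_power K R 3\<^esub> (place12 K R r \<otimes>\<^bsub>tensor_power K R 3\<^esub> place23 K R s))
        \<oplus>\<^bsub>tensor_power K R 3\<^esub> (place23 K R r \<otimes>\<^bsub>tensor_power K R 3\<^esub> place13 K R s) =
      (\<ominus>\<^bsub>K\<^esub> l) \<odot>\<^bsub>tensor_power K R 3\<^esub> place13 K R s"
    and xy: "x \<in> carrier R" "y \<in> carrier R"
  defines "P \<equiv> \<lambda>z. \<Oplus>\<^bsub>R\<^esub> i\<in>I. u i \<otimes>\<^bsub>R\<^esub> z \<otimes>\<^bsub>R\<^esub> v i"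
    and "Q \<equiv> \<lambda>z. \<Oplus>\<^bsub>R\<^esub> j\<in>J. u' j \<otimes>\<^bsub>R\<^esub> z \<otimes>\<^bsub>R\<^esub> v' j"
  shows "P x \<otimes>\<^bsub>R\<^esub> Q y = Q (x \<otimes>\<^bsub>R\<^esub> P y) \<oplus>\<^bsub>R\<^esub> P (Q x \<otimes>\<^bsub>R\<^esub> y) \<oplus>\<^bsub>R\<^esub> l \<odot>\<^bsub>R\<^esub> Q (x \<otimes>\<^bsub>R\<^esub> y)"
proof -
  obtain h where h: "h \<in> hom (formal_tensors R 3) (add_monoid R)"
    and h_of: "\<And>a b c. \<lbrakk>a \<in> carrier R; b \<in> carrier R; c \<in> carrier R\<rbrakk> \<Longrightarrow>
      h (frag_of [a, b, c]) = a \<otimes>\<^bsub>R\<^esub> x \<otimes>\<^bsub>R\<^esub> b \<otimes>\<^bsub>R\<^esub> y \<otimes>\<^bsub>R\<^esub> c"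
    and h_eq: "\<And>c d. \<lbrakk>tensor_class K R 3 c = tensor_class K R 3 d; d \<in> carrier (formal_tensors R 3)\<rbrakk> \<Longrightarrow>
      h c = h d"
    using sandwich_evaluation [OF xy] by blast
  have closed: "P z \<in> carrier R" "Q z \<in> carrier R" if "z \<in> carrier R" for z
    using that I J by (auto simp: P_def Q_def intro!: M.finsum_closed)
  \<comment> \<open>\<open>A\<close>, \<open>B\<close>, \<open>C\<close> and \<open>D\<close>
    represent \<open>r\<^sub>1\<^sub>3 s\<^sub>1\<^sub>2\<close>,
    \<open>r\<^sub>1\<^sub>2 s\<^sub>2\<^sub>3\<close>,
    \<open>r\<^sub>2\<^sub>3 s\<^sub>1\<^sub>3\<close> and the scalar multiple of
    \<open>s\<^sub>1\<^sub>3\<close>. In \<open>D\<close> the scalar stands in the first slot, where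
    \<open>formal_smult\<close> puts it.\<close>
  define A where "A = (\<Sum>i\<in>I. \<Sum>j\<in>J. frag_of [u i \<otimes>\<^bsub>R\<^esub> u' j, \<one>\<^bsub>R\<^esub> \<otimes>\<^bsub>R\<^esub> v' j, v i \<otimes>\<^bsub>R\<^esub> \<one>\<^bsub>R\<^esub>])"
  define B where "B = (\<Sum>i\<in>I. \<Sum>j\<in>J. frag_of [u i \<otimes>\<^bsub>R\<^esub> \<one>\<^bsub>R\<^esub>, v i \<otimes>\<^bsub>R\<^esub> u' j, \<one>\<^bsub>R\<^esub> \<otimes>\<^bsub>R\<^esub> v' j])"
  define C where "C = (\<Sum>i\<in>I. \<Sum>j\<in>J. frag_of [\<one>\<^bsub>R\<^esub> \<otimes>\<^bsub>R\<^esub> u' j, u i \<otimes>\<^bsub>R\<^esub> \<one>\<^bsub>R\<^esub>, v i \<otimes>\<^bsub>R\<^esub> v' j])"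
  define D where "D = (\<Sum>j\<in>J. frag_of [(\<ominus>\<^bsub>K\<^esub> l) \<odot>\<^bsub>R\<^esub> u' j, \<one>\<^bsub>R\<^esub>, v' j])"
  have carr: "A \<in> carrier (formal_tensors R 3)" "B \<in> carrier (formal_tensors R 3)"
      "C \<in> carrier (formal_tensors R 3)" "D \<in> carrier (formal_tensors R 3)"
    unfolding A_def B_def C_def D_def
    using I J l by (auto intro!: double_sum_frag_of_carrier sum_frag_of_carrier simp: tuples_def)
  have "tensor_class K R 3 A \<ominus>\<^bsub>tensor_power K R 3\<^esub> tensor_class K R 3 B
      \<oplus>\<^bsub>tensor_power K R 3\<^esub> tensor_class K R 3 C = tensor_class K R 3 D"
    using rs I J l
    by (simp add: r s place_sum tensor_power_mult_sum tensor_power_smult tuples_def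
        A_def B_def C_def D_def formal_smult_def frag_extend_sum comp_def)
  \<comment> \<open>The subtracted term moves to the other side, so that additivity of
    \<open>h\<close> suffices to evaluate both sides.\<close>
  then have "tensor_class K R 3 (A + C) = tensor_class K R 3 (D + B)"
    using carr by (simp add: tensor_power_minus tensor_power_add tensor_class_eq_iff algebra_simps)
  moreover have "D + B \<in> carrier (formal_tensors R 3)"
    using carr keys_add [of D B] by (auto simp: formal_tensors_def)
  ultimately have "h (A + C) = h (D + B)"
    by (rule h_eq)
  then have *: "h A \<oplus>\<^bsub>R\<^esub> h C = h D \<oplus>\<^bsub>R\<^esub> h B"
    using hom_mult [OF h carr(1,3)] hom_mult [OF h carr(4,2)] by (simp add: formal_tensors_def)
  have A: "h A = P (Q x \<otimes>\<^bsub>R\<^esub> y)"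
  proof -
    \<comment> \<open>The unit supplies the left free factor of
      \<open>sandwich_sandwich\<close>.\<close>
    have "P (Q x \<otimes>\<^bsub>R\<^esub> y) = P (\<one>\<^bsub>R\<^esub> \<otimes>\<^bsub>R\<^esub> Q x \<otimes>\<^bsub>R\<^esub> y)"
      using closed xy by simp
    also have "\<dots> = h A"
      unfolding A_def P_def Q_def
      by (subst hom_formal_tensors_double_sum [OF h I(1) J(1)], use I J in \<open>simp add: tuples_def\<close>,
          subst sandwich_sandwich [OF I J])
        (use I J xy in \<open>auto simp: h_of m_assoc intro!: M.finsum_cong' M.finsum_closed\<close>)
    finally show ?thesis ..
  qed
  have C: "h C = Q (x \<otimes>\<^bsub>R\<^esub> P y)"
  proof -
    have "Q (x \<otimes>\<^bsub>R\<^esub> P y) = Q (x \<otimes>\<^bsub>R\<^esub> P y \<otimes>\<^bsub>R\<^esub> \<one>\<^bsub>R\<^esub>)"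
      using closed xy by simp
    \<comment> \<open>In \<open>C\<close> the outer sum runs over \<open>I\<close>, but
      \<open>Q\<close> is the outer operator, so the sums are exchanged first.\<close>
    also have "\<dots> = h C"
      unfolding C_def P_def Q_def
      by (subst sum.swap, subst hom_formal_tensors_double_sum [OF h J(1) I(1)],
          use I J in \<open>simp add: tuples_def\<close>, subst sandwich_sandwich [OF J I])
        (use I J xy in \<open>auto simp: h_of m_assoc intro!: M.finsum_cong' M.finsum_closed\<close>)
    finally show ?thesis ..
  qed
  have D: "h D = (\<ominus>\<^bsub>K\<^esub> l) \<odot>\<^bsub>R\<^esub> Q (x \<otimes>\<^bsub>R\<^esub> y)"
    unfolding D_def Q_def
    by (subst hom_formal_tensors_sum [OF h J(1)], use J l in \<open>simp add: formal_tensors_def tuples_def\<close>,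
        subst finsum_smult_ldistr [OF J(1)])
      (use J xy l in \<open>auto simp: h_of m_assoc smult_mult_left intro!: M.finsum_cong' M.finsum_closed\<close>)
  have B: "h B = P x \<otimes>\<^bsub>R\<^esub> Q y"
    unfolding B_def P_def Q_def by (rule place12_place23_evaluation [OF I J xy h h_of])
  \<comment> \<open>By \<open>*\<close> and \<open>D\<close>, the sum of \<open>h A\<close> and
    \<open>h C\<close> contains the term with scalar \<open>-l\<close>; adding the term with scalar
    \<open>l\<close> cancels it and leaves \<open>h B\<close>.\<close>
  have "l \<odot>\<^bsub>R\<^esub> Q (x \<otimes>\<^bsub>R\<^esub> y) \<oplus>\<^bsub>R\<^esub> (h A \<oplus>\<^bsub>R\<^esub> h C) = P x \<otimes>\<^bsub>R\<^esub> Q y"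
    using closed xy l by (simp add: * D B smult_l_minus M.r_neg2)
  then show ?thesis
    using closed xy l by (simp add: A C M.a_ac)
qed

end

theorem proposition2p11:
  fixes K :: "('k, 'm) ring_scheme"
    and R :: "('k, 'r, 'n) module_scheme"
    and l :: 'k
    and \<Omega> :: "'i set"
    and I :: "'i \<Rightarrow> 'j set"
    and u v :: "'i \<Rightarrow> 'j \<Rightarrow> 'r"
    and r :: "'i \<Rightarrow> ('r list \<Rightarrow>\<^sub>0 int) set"
  assumes "cring K"
    and "l \<in> carrier K"
    and "assoc_algebra K R"
    and "\<Omega> \<noteq> {}"
    and "\<And>\<omega>. \<omega> \<in> \<Omega> \<Longrightarrow> finite (I \<omega>)"
    and "\<And>\<omega> i. \<omega> \<in> \<Omega> \<Longrightarrow> i \<in> I \<omega> \<Longrightarrow> u \<omega> i \<in> carrier R"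
    and "\<And>\<omega> i. \<omega> \<in> \<Omega> \<Longrightarrow> i \<in> I \<omega> \<Longrightarrow> v \<omega> i \<in> carrier R"
    and "\<And>\<omega>. \<omega> \<in> \<Omega> \<Longrightarrow>
           r \<omega> = (\<Oplus>\<^bsub>tensor_power K R 2\<^esub> i\<in>I \<omega>. pure_tensor K R [u \<omega> i, v \<omega> i])"
    and "polarized_AYBE_solution K l R \<Omega> r"
    and "\<And>\<alpha> \<beta>. \<alpha> \<in> \<Omega> \<Longrightarrow> \<beta> \<in> \<Omega> \<Longrightarrow>
           place12 K R (r \<alpha>) \<otimes>\<^bsub>tensor_power K R 3\<^esub> place23 K R (r \<beta>) =
           place12 K R (r \<beta>) \<otimes>\<^bsub>tensor_power K R 3\<^esub> place23 K R (r \<alpha>)"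
  shows "matching_rota_baxter_algebra K l R \<Omega>
           (\<lambda>\<omega> x. \<Oplus>\<^bsub>R\<^esub> i\<in>I \<omega>. u \<omega> i \<otimes>\<^bsub>R\<^esub> x \<otimes>\<^bsub>R\<^esub> v \<omega> i)"
proof -
  interpret assoc_algebra K R
    by fact
  define P where "P \<omega> x = (\<Oplus>\<^bsub>R\<^esub> i\<in>I \<omega>. u \<omega> i \<otimes>\<^bsub>R\<^esub> x \<otimes>\<^bsub>R\<^esub> v \<omega> i)" for \<omega> x
  note uv = assms(5-7)
  \<comment> \<open>The sum in the quotient becomes the class of one formal sum, the form that the
    operator identities expect. \<open>numeral_2_eq_2\<close> matches the length computed in
    \<open>pure_tensor\<close> with 2.\<close>
  have r: "r \<omega> = tensor_class K R 2 (\<Sum>i\<in>I \<omega>. frag_of [u \<omega> i, v \<omega> i])" if "\<omega> \<in> \<Omega>" for \<omega>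
    using finsum_tensor_class [of "I \<omega>" "\<lambda>i. frag_of [u \<omega> i, v \<omega> i]" 2] assms(8) [OF that] uv [OF that]
    by (simp add: pure_tensor_def formal_tensors_def tuples_def numeral_2_eq_2)
  have "P \<alpha> x \<otimes>\<^bsub>R\<^esub> P \<beta> y =
      P \<alpha> (x \<otimes>\<^bsub>R\<^esub> P \<beta> y) \<oplus>\<^bsub>R\<^esub> P \<beta> (P \<alpha> x \<otimes>\<^bsub>R\<^esub> y) \<oplus>\<^bsub>R\<^esub> l \<odot>\<^bsub>R\<^esub> P \<alpha> (x \<otimes>\<^bsub>R\<^esub> y)"
    if \<alpha>: "\<alpha> \<in> \<Omega>" and \<beta>: "\<beta> \<in> \<Omega>" and xy: "x \<in> carrier R" "y \<in> carrier R" for \<alpha> \<beta> x y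
  proof -
    have swap: "P \<alpha> x \<otimes>\<^bsub>R\<^esub> P \<beta> y = P \<beta> x \<otimes>\<^bsub>R\<^esub> P \<alpha> y"
      unfolding P_def
      by (rule sandwich_mult_commute [OF uv [OF \<alpha>] uv [OF \<beta>] r [OF \<alpha>] r [OF \<beta>] assms(10) [OF \<alpha> \<beta>] xy])
    \<comment> \<open>The pair is taken in the order \<beta>, \<alpha>, so that
      \<open>P \<alpha>\<close> plays the part of \<open>Q\<close> and becomes the outer operator in
      the first and last terms.\<close>
    have aybe: "(let T = tensor_power K R 3 in
        ((place13 K R (r \<beta>) \<otimes>\<^bsub>T\<^esub> place12 K R (r \<alpha>))
          \<ominus>\<^bsub>T\<^esub> (place12 K R (r \<beta>) \<otimes>\<^bsub>T\<^esub> place23 K R (r \<alpha>)))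
          \<oplus>\<^bsub>T\<^esub> (place23 K R (r \<beta>) \<otimes>\<^bsub>T\<^esub> place13 K R (r \<alpha>))
        = (\<ominus>\<^bsub>K\<^esub> l) \<odot>\<^bsub>T\<^esub> place13 K R (r \<alpha>))"
      using assms(9) \<alpha> \<beta> unfolding polarized_AYBE_solution_def Let_def by blast
    have "P \<beta> x \<otimes>\<^bsub>R\<^esub> P \<alpha> y =
        P \<alpha> (x \<otimes>\<^bsub>R\<^esub> P \<beta> y) \<oplus>\<^bsub>R\<^esub> P \<beta> (P \<alpha> x \<otimes>\<^bsub>R\<^esub> y) \<oplus>\<^bsub>R\<^esub> l \<odot>\<^bsub>R\<^esub> P \<alpha> (x \<otimes>\<^bsub>R\<^esub> y)"
      unfolding P_def
      by (rule AYBE_sandwich [OF uv [OF \<beta>] uv [OF \<alpha>] r [OF \<beta>] r [OF \<alpha>] assms(2)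
            aybe [unfolded Let_def] xy])
    with swap show ?thesis
      by simp
  qed
  moreover have "linear_operator K R (P \<omega>)" if "\<omega> \<in> \<Omega>" for \<omega>
    unfolding P_def by (rule linear_operator_sandwich [OF uv [OF that]])
  ultimately have "matching_rota_baxter_algebra K l R \<Omega> P"
    using assms(3) by (simp add: matching_rota_baxter_algebra_def)
  then show ?thesis
    by (simp add: P_def [abs_def])
qed

end
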